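(* Let $\omega=(\omega_1,\dots,\omega_N)$ be weights with $\omega_j\ge1$ for all $j$, let $\nu_\omega(S)=\sum_{i\in S}\omega_i^2$, and let $C$ be the absolute constant described in the context. If positive integers $m,s,N$ satisfy $$\frac{N}{2}\ge m\ge 81\,C\,s\log^3(3s)\log(N),\qquad N\ge 24\|\omega\|_\infty^2 s,\qquad s>23040\,\|\omega\|_\infty^6,$$ then there exists a matrix $\Phi\in\mathbb{C}^{m\times N}$ that satisfies $\omega$-NSP of order $s$ but does not satisfy $\omega$-RIP-NSP of order $3s$ with $\delta_{\omega,3s}<1/3$ (that is, no matrix with the same null space as $\Phi$ has $\omega$-RIP constant of order $3s$ less than $1/3$).
   Context: $[N]=\{1,\dots,N\}$; $\|x\|_{\omega,1}=\sum_{j=1}^N\omega_j|x_j|$; $\|\omega\|_\infty=\max_j\omega_j$; for $S\subset[N]$, $x_S$ equals $x$ on $S$ and is zero elsewhere, $S^c=[N]\setminus S$; $\log$ is the natural logarithm. $\omega$-NSP of order $s$: $A\in\mathbb{C}^{m\times N}$ satisfies it if $\|v_S\|_{\omega,1}<\|v_{S^c}\|_{\omega,1}$ for all $v\in\ker(A)\setminus\{0\}$ and all $S\subset[N]$ with $\sum_{i\in S}\omega_i^2\le s$. $\omega$-RIP: the $\omega$-RIP constant $\delta_{\omega,k}$ of order $k$ of a matrix $A$ is the smallest number such that $(1-\delta_{\omega,k})\|x\|_2^2\le\|Ax\|_2^2\le(1+\delta_{\omega,k})\|x\|_2^2$ for every $x\in\mathbb{C}^N$ whose support $S$ satisfies $\sum_{i\in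 S}\omega_i^2\le k$. A matrix $\Phi$ satisfies $\omega$-RIP-NSP of order $k$ with $\delta_{\omega,k}$ if it has the same null space as a matrix that satisfies $\omega$-RIP of order $k$ with constant $\delta_{\omega,k}$. The constant $C$: $C>0$ is an absolute constant for which the following theorem (Rauhut–Ward) holds. Let $\delta\in(0,1)$, let $(\psi_j)_{j\in\Lambda}$ be an orthonormal system of functions of finite size $N=|\Lambda|$ with respect to a probability measure, let the weights satisfy $\omega_j\ge\|\psi_j\|_\infty$, let $s\ge2\|\omega\|_\infty^2$ and $m\ge C\delta^{-2}s\log^3(s)\log(N)$, and let $t_1,\dots,t_m$ be drawn independently from that measure. Then the matrix $A\in\mathbb{C}^{m\times N}$ with entries $A_{\ell,k}=\frac{1}{\sqrt m}\psi_k(t_\ell)$ satisfies $\delta_{\omega,s}\le\delta$ with probability exceeding $1-N^{-\log^3(s)}$. *)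

theory Defs
  imports "HOL-Probability.Probability" "Jordan_Normal_Form.Matrix_Kernel"
begin

unbundle no vec_syntax

text \<open>Coordinates are numbered from 0, so the index set is \<open>{..<N}\<close>. Vectors and matrices are
  those of Jordan_Normal_Form, whose dimensions are ordinary natural numbers.\<close>

definition vec_support :: "complex vec \<Rightarrow> nat set" where
  "vec_support x = {i. i < dim_vec x \<and> x $ i \<noteq> 0}"

definition vec_restrict :: "complex vec \<Rightarrow> nat set \<Rightarrow> complex vec" where
  "vec_restrict x S = vec (dim_vec x) (\<lambda>i. if i \<in> S then x $ i else 0)"

definition l2_norm :: "complex vec \<Rightarrow> real" where
  "l2_norm x = L2_set (\<lambda>i. cmod (x $ i)) {..<dim_vec x}"

definition weighted_l1_norm :: "(nat \<Rightarrow> real) \<Rightarrow> complex vec \<Rightarrow> real" where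
  "weighted_l1_norm \<omega> x = (\<Sum>j<dim_vec x. \<omega> j * cmod (x $ j))"

definition weighted_card :: "(nat \<Rightarrow> real) \<Rightarrow> nat set \<Rightarrow> real" where
  "weighted_card \<omega> S = (\<Sum>i\<in>S. (\<omega> i)\<^sup>2)"

definition weight_max :: "nat \<Rightarrow> (nat \<Rightarrow> real) \<Rightarrow> real" where
  "weight_max N \<omega> = Max (\<omega> ` {..<N})"

definition weighted_NSP :: "(nat \<Rightarrow> real) \<Rightarrow> real \<Rightarrow> complex mat \<Rightarrow> bool" where
  "weighted_NSP \<omega> s A \<longleftrightarrow>
    (\<forall>v \<in> mat_kernel A - {0\<^sub>v (dim_col A)}. \<forall>S \<subseteq> {..<dim_col A}. weighted_card \<omega> S \<le> s \<longrightarrow>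
      weighted_l1_norm \<omega> (vec_restrict v S)
        < weighted_l1_norm \<omega> (vec_restrict v ({..<dim_col A} - S)))"

text \<open>The infimum is attained as soon as some nonzero \<open>x\<close> is admissible, that is, as soon as
  \<open>(\<omega> j)\<^sup>2 \<le> k\<close> for some column index \<open>j\<close>. All uses below have \<open>k \<ge> (weight_max N \<omega>)\<^sup>2\<close>;
  otherwise there is no smallest \<open>\<delta>\<close> and the value is irrelevant.\<close>

definition weighted_RIP_const :: "(nat \<Rightarrow> real) \<Rightarrow> real \<Rightarrow> complex mat \<Rightarrow> real" where
  "weighted_RIP_const \<omega> k A = Inf {\<delta>. \<forall>x \<in> carrier_vec (dim_col A).
      weighted_card \<omega> (vec_support x) \<le> k \<longrightarrow>
        (1 - \<delta>) * (l2_norm x)\<^sup>2 \<le> (l2_norm (A *\<^sub>v x))\<^sup>2 \<and>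
        (l2_norm (A *\<^sub>v x))\<^sup>2 \<le> (1 + \<delta>) * (l2_norm x)\<^sup>2}"

text \<open>The matrix \<open>\<Psi>\<close> may have a different number of rows than \<open>\<Phi>\<close>.\<close>

definition weighted_RIP_NSP :: "(nat \<Rightarrow> real) \<Rightarrow> real \<Rightarrow> real \<Rightarrow> complex mat \<Rightarrow> bool" where
  "weighted_RIP_NSP \<omega> k \<delta> \<Phi> \<longleftrightarrow>
    (\<exists>\<Psi>. dim_col \<Psi> = dim_col \<Phi> \<and> mat_kernel \<Psi> = mat_kernel \<Phi> \<and> weighted_RIP_const \<omega> k \<Psi> = \<delta>)"

definition orthonormal_system :: "'a measure \<Rightarrow> nat \<Rightarrow> (nat \<Rightarrow> 'a \<Rightarrow> complex) \<Rightarrow> bool" where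
  "orthonormal_system M N \<psi> \<longleftrightarrow>
    (\<forall>j<N. \<psi> j \<in> borel_measurable M) \<and>
    (\<forall>j<N. \<forall>k<N. integrable M (\<lambda>t. \<psi> j t * cnj (\<psi> k t)) \<and>
      (LINT t|M. \<psi> j t * cnj (\<psi> k t)) = (if j = k then 1 else 0))"

definition sampling_matrix ::
    "nat \<Rightarrow> nat \<Rightarrow> (nat \<Rightarrow> 'a \<Rightarrow> complex) \<Rightarrow> (nat \<Rightarrow> 'a) \<Rightarrow> complex mat" where
  "sampling_matrix m N \<psi> t = mat m N (\<lambda>(l, k). \<psi> k (t l) / complex_of_real (sqrt (real m)))"

text \<open>\<open>C\<close> is a constant for which the Rauhut--Ward theorem holds. The sample points
  \<open>t 0, \<dots>, t (m - 1)\<close> are independent with law \<open>M\<close>, i.e. distributed according to the product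
  measure. Sample spaces are taken on the real line, because a definition cannot quantify over
  types. This is no restriction: the event depends only on the joint law of
  \<open>(\<psi> 0, \<dots>, \<psi> (N - 1))\<close> on \<open>N\<close>-dimensional complex space, a standard Borel space.
  The condition \<open>N \<ge> 2\<close> excludes the degenerate case \<open>ln N = 0\<close>, in which the bound on \<open>m\<close> is void
  and the theorem fails for every \<open>C\<close> (take \<open>m = 1\<close> and \<open>\<psi> 0\<close> with values 0 and \<open>sqrt 2\<close>).\<close>

definition rauhut_ward_constant :: "real \<Rightarrow> bool" where
  "rauhut_ward_constant C \<longleftrightarrow> C > 0 \<and>
    (\<forall>(\<delta>::real) (M::real measure) (N::nat) (\<psi>::nat \<Rightarrow> real \<Rightarrow> complex) (\<omega>::nat \<Rightarrow> real)
        (s::real) (m::nat).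
      0 < \<delta> \<longrightarrow> \<delta> < 1 \<longrightarrow> N \<ge> 2 \<longrightarrow>
      prob_space M \<longrightarrow> orthonormal_system M N \<psi> \<longrightarrow>
      (\<forall>j<N. \<forall>t\<in>space M. cmod (\<psi> j t) \<le> \<omega> j) \<longrightarrow>
      s \<ge> 2 * (weight_max N \<omega>)\<^sup>2 \<longrightarrow>
      real m \<ge> C * (1 / \<delta>\<^sup>2) * s * (ln s) ^ 3 * ln (real N) \<longrightarrow>
      measure (Pi\<^sub>M {..<m} (\<lambda>_. M))
          {t \<in> space (Pi\<^sub>M {..<m} (\<lambda>_. M)). weighted_RIP_const \<omega> s (sampling_matrix m N \<psi> t) \<le> \<delta>}
        > 1 - real N powr (- ((ln s) ^ 3)))"

end

theory Submission
  imports Defs "HOL-Library.Real_Mod"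
begin

text \<open>
  A matrix with the weighted restricted isometry property of order \<open>3 * s\<close> forces strong spreading
  on every vector \<open>v\<close> of its kernel. Split the complement of an admissible set \<open>S\<close> into blocks of
  weighted size about \<open>2 * s\<close> with decreasing ratios \<open>cmod (v j) / \<omega> j\<close>; the euclidean norm of each
  block is controlled by the weighted \<open>\<ell>\<^sub>1\<close> norm of the preceding block. This gives
  \<open>weighted_RIP_kernel_bound\<close>, a bound for the euclidean norm of \<open>v\<close> on \<open>S\<close> of the order of
  \<open>1 / sqrt s\<close> times the weighted \<open>\<ell>\<^sub>1\<close> norm of \<open>v\<close> off \<open>S\<close>. It has two consequences: the kernel
  satisfies the weighted null space property with room to spare (\<open>weighted_RIP_l1_nsp\<close>), and no
  entry of a kernel vector exceeds a fixed small multiple of its weighted \<open>\<ell>\<^sub>1\<close> norm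
  (\<open>weighted_RIP_kernel_entry_le\<close>).

  The null space property does not see the second consequence. The constant \<open>C\<close>, applied to the
  discrete Fourier system with \<open>\<delta> = 1 / sqrt 27\<close> and order \<open>3 * s\<close>, provides an \<open>m \<times> N\<close> matrix
  \<open>A\<close> with the restricted isometry property (\<open>ex_matrix_weighted_RIP_const_le\<close>); note
  \<open>81 = 27 * 3\<close>. As \<open>m < N\<close>, there is a nonzero \<open>u\<close> in its kernel. Let \<open>c\<close> be the linear
  functional on vectors, independent of one coordinate \<open>k\<close>, that aligns phases with \<open>u\<close> and has
  dual norm at most \<open>1 / (60 * W)\<close>, where \<open>W\<close> is the largest weight, and move the kernel of \<open>A\<close> by
  the shear \<open>x \<mapsto> x + c(x) e\<^sub>k\<close>. The weighted \<open>\<ell>\<^sub>1\<close> norms change by a fraction of at most about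
  1/60, so the null space property survives. But the image of \<open>u\<close> has an entry of size about
  \<open>1 / (60 * W)\<close> times its weighted \<open>\<ell>\<^sub>1\<close> norm. The entry bound forbids this for kernel vectors of
  every matrix whose restricted isometry constant is less than 1/3, as \<open>s\<close> is large.
\<close>

section \<open>Block decompositions\<close>

text \<open>A set of total weight more than \<open>k\<close> has a part of largest ratios \<open>r\<close> whose weight misses \<open>k\<close>
  by at most a common bound \<open>b\<close> of the single weights: discard elements of smallest ratio until the weight
  drops to at most \<open>k\<close>.\<close>

lemma ex_initial_block:
  fixes w r :: "nat \<Rightarrow> real"
  assumes "finite T" and "\<And>j. j \<in> T \<Longrightarrow> w j \<le> b" and "0 \<le> k" and "k < sum w T"
  shows "\<exists>U\<subseteq>T. k - b \<le> sum w U \<and> sum w U \<le> k \<and> (\<forall>i\<in>U. \<forall>j\<in>T - U. r j \<le> r i)"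
  using assms(1,2,4)
proof (induction T rule: finite_psubset_induct)
  case (psubset T)
  have "T \<noteq> {}" using psubset.prems(2) assms(3) by auto
  then have "Min (r ` T) \<in> r ` T" using psubset.hyps by (intro Min_in) auto
  then obtain j where j: "j \<in> T" "r j = Min (r ` T)" by auto
  have jmin: "r j \<le> r i" if "i \<in> T" for i
    using j(2) that psubset.hyps by simp
  have sum_eq: "sum w T = w j + sum w (T - {j})"
    using psubset.hyps j(1) by (simp add: sum.remove)
  show ?case
  proof (cases "sum w (T - {j}) \<le> k")
    case True
    have "w j \<le> b" using psubset.prems(1) j(1) by blast
    then show ?thesis
      using True sum_eq psubset.prems(2) jmin j(1)
      by (intro exI[of _ "T - {j}"]) auto
  next
    case False
    have "\<exists>U\<subseteq>T - {j}. k - b \<le> sum w U \<and> sum w U \<le> k \<and> (\<forall>i\<in>U. \<forall>i'\<in>(T - {j}) - U. r i' \<le> r i)"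
      using False j(1) psubset.prems(1) by (intro psubset.IH) auto
    then obtain U where "U \<subseteq> T - {j}" "k - b \<le> sum w U" "sum w U \<le> k"
      "\<forall>i\<in>U. \<forall>i'\<in>(T - {j}) - U. r i' \<le> r i" by blast
    then show ?thesis using jmin by (intro exI[of _ U]) auto
  qed
qed

lemma L2_set_le_weighted_bound:
  fixes a \<omega> :: "nat \<Rightarrow> real"
  assumes "\<And>j. j \<in> U \<Longrightarrow> 0 \<le> a j" "\<And>j. j \<in> U \<Longrightarrow> a j \<le> \<mu> * \<omega> j"
    and "0 \<le> \<mu>" "(\<Sum>j\<in>U. (\<omega> j)\<^sup>2) \<le> k"
  shows "L2_set a U \<le> \<mu> * sqrt k"
proof -
  have "(\<Sum>j\<in>U. (a j)\<^sup>2) \<le> (\<Sum>j\<in>U. \<mu>\<^sup>2 * (\<omega> j)\<^sup>2)"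
    using assms(1,2) by (intro sum_mono) (metis power_mono power_mult_distrib)
  also have "\<dots> \<le> \<mu>\<^sup>2 * k"
    using assms(4) by (simp add: mult_left_mono flip: sum_distrib_left)
  finally show ?thesis
    unfolding L2_set_def using assms(3) by (metis real_sqrt_le_iff real_sqrt_mult real_sqrt_abs abs_of_nonneg)
qed

text \<open>Every ratio after a block is at most the weighted mean ratio on the block; \<open>d\<close> is a lower bound
  for the weight of the block.\<close>

lemma block_ratio_bound:
  fixes a \<omega> :: "nat \<Rightarrow> real"
  assumes "finite T" "U \<subseteq> T" and pos: "\<And>j. j \<in> T \<Longrightarrow> 0 < \<omega> j"
    and nonneg: "\<And>j. j \<in> T \<Longrightarrow> 0 \<le> a j"
    and order: "\<forall>i\<in>U. \<forall>j\<in>T - U. a j / \<omega> j \<le> a i / \<omega> i"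
    and size: "d \<le> (\<Sum>j\<in>U. (\<omega> j)\<^sup>2)" "0 < d" and "j \<in> T - U"
  shows "a j \<le> (\<Sum>i\<in>U. \<omega> i * a i) / d * \<omega> j"
proof -
  let ?q = "a j / \<omega> j"
  have j: "0 < \<omega> j" "0 \<le> a j" using assms by auto
  have "?q * d \<le> ?q * (\<Sum>i\<in>U. (\<omega> i)\<^sup>2)"
    using size j by (intro mult_left_mono) auto
  also have "\<dots> = (\<Sum>i\<in>U. ?q * (\<omega> i)\<^sup>2)" by (simp add: sum_distrib_left)
  also have "\<dots> \<le> (\<Sum>i\<in>U. \<omega> i * a i)"
  proof (rule sum_mono)
    fix i assume i: "i \<in> U"
    have wi: "0 < \<omega> i" using i assms(2) pos by auto
    have "?q * (\<omega> i)\<^sup>2 \<le> (a i / \<omega> i) * (\<omega> i)\<^sup>2"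
      using order i assms(8) by (intro mult_right_mono) auto
    also have "\<dots> = \<omega> i * a i" using wi by (simp add: power2_eq_square)
    finally show "?q * (\<omega> i)\<^sup>2 \<le> \<omega> i * a i" .
  qed
  finally have "?q \<le> (\<Sum>i\<in>U. \<omega> i * a i) / d" using size(2) by (simp add: pos_le_divide_eq)
  then show ?thesis using j by (simp add: pos_divide_le_eq)
qed

text \<open>Here \<open>P U\<close> stands for the norm of the image of a vector restricted to \<open>U\<close>, and \<open>\<mu>\<close> bounds the
  ratios on \<open>T\<close>. The induction removes the block of largest ratios; a bound for the mean ratio on that
  block is the new \<open>\<mu>\<close>, which turns the first summand into a part of the second.\<close>

lemma subadditive_tail_bound:
  fixes P :: "nat set \<Rightarrow> real" and a \<omega> :: "nat \<Rightarrow> real"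
  assumes "finite T" and "\<And>j. j \<in> T \<Longrightarrow> 0 < \<omega> j" and "\<And>j. j \<in> T \<Longrightarrow> (\<omega> j)\<^sup>2 \<le> b"
    and "0 \<le> b" "b < k" "0 \<le> c"
    and "\<And>j. j \<in> T \<Longrightarrow> 0 \<le> a j" and "\<And>j. j \<in> T \<Longrightarrow> a j \<le> \<mu> * \<omega> j" and "0 \<le> \<mu>"
    and "\<And>U V. U \<subseteq> T \<Longrightarrow> V \<subseteq> T \<Longrightarrow> U \<inter> V = {} \<Longrightarrow> P (U \<union> V) \<le> P U + P V"
    and "\<And>U. U \<subseteq> T \<Longrightarrow> (\<Sum>j\<in>U. (\<omega> j)\<^sup>2) \<le> k \<Longrightarrow> P U \<le> c * L2_set a U"
  shows "P T \<le> c * (\<mu> * sqrt k + sqrt k / (k - b) * (\<Sum>j\<in>T. \<omega> j * a j))"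
  using assms(1-3,7-)
proof (induction T arbitrary: \<mu> rule: finite_psubset_induct)
  case (psubset T)
  let ?\<beta> = "sqrt k / (k - b)"
  have sub: "P U \<le> c * (\<mu> * sqrt k)" if "U \<subseteq> T" "(\<Sum>j\<in>U. (\<omega> j)\<^sup>2) \<le> k" for U
  proof -
    have "L2_set a U \<le> \<mu> * sqrt k"
      using that psubset.prems(3-5) by (intro L2_set_le_weighted_bound[where \<omega> = \<omega>]) auto
    then have "c * L2_set a U \<le> c * (\<mu> * sqrt k)" using assms(6) by (rule mult_left_mono)
    then show ?thesis using psubset.prems(7)[OF that] by linarith
  qed
  have nn: "0 \<le> (\<Sum>j\<in>V. \<omega> j * a j)" if "V \<subseteq> T" for V
    using that psubset.prems(1,3) by (intro sum_nonneg mult_nonneg_nonneg) (auto simp: less_imp_le)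
  show ?case
  proof (cases "(\<Sum>j\<in>T. (\<omega> j)\<^sup>2) \<le> k")
    case True
    have "0 \<le> ?\<beta> * (\<Sum>j\<in>T. \<omega> j * a j)" using nn assms(4,5) by simp
    then have "0 \<le> c * (?\<beta> * (\<Sum>j\<in>T. \<omega> j * a j))"
      using mult_nonneg_nonneg[OF assms(6)] by blast
    then show ?thesis using sub[OF order_refl True] unfolding distrib_left by linarith
  next
    case False
    obtain U where U: "U \<subseteq> T" "k - b \<le> (\<Sum>j\<in>U. (\<omega> j)\<^sup>2)" "(\<Sum>j\<in>U. (\<omega> j)\<^sup>2) \<le> k"
      "\<forall>i\<in>U. \<forall>j\<in>T - U. a j / \<omega> j \<le> a i / \<omega> i"
      using ex_initial_block[of T "\<lambda>j. (\<omega> j)\<^sup>2" b k "\<lambda>j. a j / \<omega> j"]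
        psubset.hyps psubset.prems(2) False assms(4,5) by auto
    have "U \<noteq> {}" using U(2) assms(5) by auto
    let ?\<nu> = "(\<Sum>i\<in>U. \<omega> i * a i) / (k - b)"
    have nu: "a j \<le> ?\<nu> * \<omega> j" if "j \<in> T - U" for j
      using block_ratio_bound[OF psubset.hyps U(1) psubset.prems(1,3) U(4,2) _ that] assms(5) by auto
    have "P (T - U) \<le> c * (?\<nu> * sqrt k + ?\<beta> * (\<Sum>j\<in>T - U. \<omega> j * a j))"
    proof (rule psubset.IH)
      show "T - U \<subset> T" using U(1) \<open>U \<noteq> {}\<close> by blast
      show "0 \<le> ?\<nu>" using nn[OF U(1)] assms(5) by simp
      show "P (X \<union> Y) \<le> P X + P Y" if "X \<subseteq> T - U" "Y \<subseteq> T - U" "X \<inter> Y = {}" for X Y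
        by (rule psubset.prems(6)) (use that in auto)
      show "P X \<le> c * L2_set a X" if "X \<subseteq> T - U" "(\<Sum>j\<in>X. (\<omega> j)\<^sup>2) \<le> k" for X
        by (rule psubset.prems(7)) (use that in auto)
      show "a j \<le> ?\<nu> * \<omega> j" if "j \<in> T - U" for j by (rule nu[OF that])
    qed (use psubset.prems(1-3) in auto)
    also have "?\<nu> * sqrt k + ?\<beta> * (\<Sum>j\<in>T - U. \<omega> j * a j)
        = ?\<beta> * ((\<Sum>j\<in>U. \<omega> j * a j) + (\<Sum>j\<in>T - U. \<omega> j * a j))"
      by (simp add: distrib_left mult.commute)
    also have "(\<Sum>j\<in>U. \<omega> j * a j) + (\<Sum>j\<in>T - U. \<omega> j * a j) = (\<Sum>j\<in>T. \<omega> j * a j)"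
      using sum.subset_diff[OF U(1) psubset.hyps, of "\<lambda>j. \<omega> j * a j"] by simp
    finally have 1: "P (T - U) \<le> c * (?\<beta> * (\<Sum>j\<in>T. \<omega> j * a j))" .
    have "P T \<le> P U + P (T - U)"
      using psubset.prems(6)[of U "T - U"] U(1) by (simp add: Un_absorb1)
    then show ?thesis using 1 sub[OF U(1) U(3)] unfolding distrib_left by linarith
  qed
qed

text \<open>\<open>S\<close> together with the first block \<open>U\<close> of its complement is small enough for the lower bound, and
  the kernel condition moves the estimate to the remaining blocks.
  The hypotheses on \<open>P\<close> hold for \<open>P U = l2_norm (A *\<^sub>v vec_restrict v U)\<close> when \<open>v\<close> lies in the
  kernel of a matrix \<open>A\<close> with the restricted isometry property of order \<open>k + l\<close>,
  with \<open>c = sqrt (1 + \<delta>)\<close> and \<open>d = sqrt (1 - \<delta>)\<close>.\<close>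

lemma l2_robust_nsp_abstract:
  fixes P :: "nat set \<Rightarrow> real" and a \<omega> :: "nat \<Rightarrow> real"
  assumes I: "finite I" and pos: "\<And>j. j \<in> I \<Longrightarrow> 0 < \<omega> j" and b: "\<And>j. j \<in> I \<Longrightarrow> (\<omega> j)\<^sup>2 \<le> b"
    and k: "0 \<le> b" "b < k" "0 \<le> l" and c: "0 \<le> c" "0 < d"
    and a: "\<And>j. j \<in> I \<Longrightarrow> 0 \<le> a j"
    and sub: "\<And>U V. U \<subseteq> I \<Longrightarrow> V \<subseteq> I \<Longrightarrow> U \<inter> V = {} \<Longrightarrow> P (U \<union> V) \<le> P U + P V"
    and up: "\<And>U. U \<subseteq> I \<Longrightarrow> (\<Sum>j\<in>U. (\<omega> j)\<^sup>2) \<le> k + l \<Longrightarrow> P U \<le> c * L2_set a U"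
    and low: "\<And>U. U \<subseteq> I \<Longrightarrow> (\<Sum>j\<in>U. (\<omega> j)\<^sup>2) \<le> k + l \<Longrightarrow> d * L2_set a U \<le> P U"
    and ker: "\<And>U. U \<subseteq> I \<Longrightarrow> P U = P (I - U)"
    and S: "S \<subseteq> I" "(\<Sum>j\<in>S. (\<omega> j)\<^sup>2) \<le> l"
  shows "d * L2_set a S \<le> c * (sqrt k / (k - b)) * (\<Sum>j\<in>I - S. \<omega> j * a j)"
proof -
  let ?T = "I - S" and ?\<beta> = "sqrt k / (k - b)"
  have nn: "0 \<le> (\<Sum>j\<in>V. \<omega> j * a j)" if "V \<subseteq> I" for V
    using that pos a by (intro sum_nonneg mult_nonneg_nonneg) (auto simp: less_imp_le)
  have fS: "finite S" using S(1) I finite_subset by blast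
  have mono: "L2_set a S \<le> L2_set a V" if "S \<subseteq> V" "V \<subseteq> I" for V
    unfolding L2_set_def using that finite_subset[OF _ I] by (intro real_sqrt_le_mono sum_mono2) auto
  have main: "d * L2_set a S \<le> P (I - V)"
    if "S \<subseteq> V" "V \<subseteq> I" "(\<Sum>j\<in>V. (\<omega> j)\<^sup>2) \<le> k + l" for V
  proof -
    have "d * L2_set a S \<le> d * L2_set a V" using mono[OF that(1,2)] c(2) by simp
    then show ?thesis using low[OF that(2,3)] ker[OF that(2)] by linarith
  qed
  show ?thesis
  proof (cases "(\<Sum>j\<in>?T. (\<omega> j)\<^sup>2) \<le> k")
    case True
    have "(\<Sum>j\<in>I. (\<omega> j)\<^sup>2) \<le> k + l"
      using True S sum.subset_diff[OF S(1) I, of "\<lambda>j. (\<omega> j)\<^sup>2"] by simp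
    then have "d * L2_set a S \<le> P {}" using main[OF S(1)] by simp
    also have "P {} \<le> 0" using up[of "{}"] k by simp
    finally have "d * L2_set a S \<le> 0" .
    moreover have "0 \<le> c * ?\<beta> * (\<Sum>j\<in>?T. \<omega> j * a j)" using nn[of ?T] c k by simp
    ultimately show ?thesis by linarith
  next
    case False
    obtain U where U: "U \<subseteq> ?T" "k - b \<le> (\<Sum>j\<in>U. (\<omega> j)\<^sup>2)" "(\<Sum>j\<in>U. (\<omega> j)\<^sup>2) \<le> k"
      "\<forall>i\<in>U. \<forall>j\<in>?T - U. a j / \<omega> j \<le> a i / \<omega> i"
      using ex_initial_block[of ?T "\<lambda>j. (\<omega> j)\<^sup>2" b k "\<lambda>j. a j / \<omega> j"] False I b k by auto
    let ?\<nu> = "(\<Sum>i\<in>U. \<omega> i * a i) / (k - b)"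
    have nu: "a j \<le> ?\<nu> * \<omega> j" if "j \<in> ?T - U" for j
      using pos a I U(2) k by (intro block_ratio_bound[OF _ U(1) _ _ U(4) _ _ that]) auto
    have "P (?T - U) \<le> c * (?\<nu> * sqrt k + ?\<beta> * (\<Sum>j\<in>?T - U. \<omega> j * a j))"
    proof (rule subadditive_tail_bound)
      show "P X \<le> c * L2_set a X" if "X \<subseteq> ?T - U" "(\<Sum>j\<in>X. (\<omega> j)\<^sup>2) \<le> k" for X
        using that k by (intro up) auto
      show "P (X \<union> Y) \<le> P X + P Y" if "X \<subseteq> ?T - U" "Y \<subseteq> ?T - U" "X \<inter> Y = {}" for X Y
        using that by (intro sub) auto
      have "0 \<le> (\<Sum>i\<in>U. \<omega> i * a i)" using U(1) by (intro nn) auto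
      then show "0 \<le> ?\<nu>" using k by (intro divide_nonneg_nonneg) auto
      show "a j \<le> ?\<nu> * \<omega> j" if "j \<in> ?T - U" for j by (rule nu[OF that])
    qed (use I pos b a k c in auto)
    also have "?\<nu> * sqrt k + ?\<beta> * (\<Sum>j\<in>?T - U. \<omega> j * a j)
        = ?\<beta> * ((\<Sum>j\<in>U. \<omega> j * a j) + (\<Sum>j\<in>?T - U. \<omega> j * a j))"
      by (simp add: distrib_left mult.commute)
    also have "(\<Sum>j\<in>U. \<omega> j * a j) + (\<Sum>j\<in>?T - U. \<omega> j * a j) = (\<Sum>j\<in>?T. \<omega> j * a j)"
      using sum.subset_diff[OF U(1), of "\<lambda>j. \<omega> j * a j"] I by simp
    finally have "P (?T - U) \<le> c * ?\<beta> * (\<Sum>j\<in>?T. \<omega> j * a j)" by (simp add: mult.assoc)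
    moreover have "d * L2_set a S \<le> P (I - (S \<union> U))"
    proof (rule main)
      have "(\<Sum>j\<in>S \<union> U. (\<omega> j)\<^sup>2) = (\<Sum>j\<in>S. (\<omega> j)\<^sup>2) + (\<Sum>j\<in>U. (\<omega> j)\<^sup>2)"
        using U(1) I finite_subset fS by (intro sum.union_disjoint) blast+
      then show "(\<Sum>j\<in>S \<union> U. (\<omega> j)\<^sup>2) \<le> k + l" using U(3) S(2) by simp
    qed (use S U in auto)
    ultimately show ?thesis by (simp add: Diff_eq Int_assoc)
  qed
qed

section \<open>Restricted isometries and their kernels\<close>

text \<open>The two inequalities that a real number must satisfy to be an upper bound for the restricted
  isometry constant.\<close>

definition weighted_RIP :: "(nat \<Rightarrow> real) \<Rightarrow> real \<Rightarrow> complex mat \<Rightarrow> real \<Rightarrow> bool" where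
  "weighted_RIP \<omega> k A \<delta> \<longleftrightarrow> (\<forall>x \<in> carrier_vec (dim_col A).
      weighted_card \<omega> (vec_support x) \<le> k \<longrightarrow>
        (1 - \<delta>) * (l2_norm x)\<^sup>2 \<le> (l2_norm (A *\<^sub>v x))\<^sup>2 \<and>
        (l2_norm (A *\<^sub>v x))\<^sup>2 \<le> (1 + \<delta>) * (l2_norm x)\<^sup>2)"

lemma mult_mat_vec_index_sum:
  assumes "A \<in> carrier_mat m N" "x \<in> carrier_vec N" "i < m"
  shows "(A *\<^sub>v x) $ i = (\<Sum>j<N. A $$ (i, j) * x $ j)"
  using assms by (auto simp: scalar_prod_def atLeast0LessThan intro!: sum.cong)

lemma l2_norm_add_le:
  assumes "x \<in> carrier_vec n" "y \<in> carrier_vec n"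
  shows "l2_norm (x + y) \<le> l2_norm x + l2_norm y"
proof -
  have "L2_set (\<lambda>i. cmod (x $ i + y $ i)) {..<n} \<le> L2_set (\<lambda>i. cmod (x $ i) + cmod (y $ i)) {..<n}"
    by (intro L2_set_mono norm_triangle_ineq) auto
  also have "\<dots> \<le> L2_set (\<lambda>i. cmod (x $ i)) {..<n} + L2_set (\<lambda>i. cmod (y $ i)) {..<n}"
    by (rule L2_set_triangle_ineq)
  also have "L2_set (\<lambda>i. cmod (x $ i + y $ i)) {..<n} = l2_norm (x + y)"
    using assms unfolding l2_norm_def by (intro L2_set_cong) auto
  finally show ?thesis using assms by (simp add: l2_norm_def)
qed

lemma l2_norm_mult_mat_vec_bound:
  "\<exists>c\<ge>0. \<forall>x\<in>carrier_vec (dim_col A). (l2_norm (A *\<^sub>v x))\<^sup>2 \<le> c * (l2_norm x)\<^sup>2"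
proof (intro exI conjI ballI)
  let ?c = "\<Sum>i<dim_row A. (L2_set (\<lambda>j. cmod (A $$ (i, j))) {..<dim_col A})\<^sup>2"
  show "0 \<le> ?c" by (intro sum_nonneg) simp
  fix x :: "complex vec" assume x: "x \<in> carrier_vec (dim_col A)"
  have "(cmod ((A *\<^sub>v x) $ i))\<^sup>2 \<le> (L2_set (\<lambda>j. cmod (A $$ (i, j))) {..<dim_col A})\<^sup>2 * (l2_norm x)\<^sup>2"
    if i: "i < dim_row A" for i
  proof -
    have "cmod ((A *\<^sub>v x) $ i) = cmod (\<Sum>j<dim_col A. A $$ (i, j) * x $ j)"
      using mult_mat_vec_index_sum[OF _ x i] by simp
    also have "\<dots> \<le> (\<Sum>j<dim_col A. \<bar>cmod (A $$ (i, j))\<bar> * \<bar>cmod (x $ j)\<bar>)"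
      by (rule norm_sum[THEN order_trans]) (simp add: norm_mult)
    also have "\<dots> \<le> L2_set (\<lambda>j. cmod (A $$ (i, j))) {..<dim_col A} * l2_norm x"
      using x L2_set_mult_ineq[of "\<lambda>j. cmod (A $$ (i, j))" "\<lambda>j. cmod (x $ j)" "{..<dim_col A}"]
      by (simp add: l2_norm_def)
    finally show ?thesis by (simp add: power_mono flip: power_mult_distrib)
  qed
  then have "(\<Sum>i<dim_row A. (cmod ((A *\<^sub>v x) $ i))\<^sup>2) \<le> ?c * (l2_norm x)\<^sup>2"
    unfolding sum_distrib_right by (intro sum_mono) auto
  then show "(l2_norm (A *\<^sub>v x))\<^sup>2 \<le> ?c * (l2_norm x)\<^sup>2"
    by (simp add: l2_norm_def L2_set_def[of _ "{..<dim_row A}"] sum_nonneg)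
qed

lemma weighted_RIP_nonneg:
  assumes "0 < dim_col A" "(\<omega> 0)\<^sup>2 \<le> k" "weighted_RIP \<omega> k A \<delta>"
  shows "0 \<le> \<delta>"
proof -
  let ?e = "unit_vec (dim_col A) 0 :: complex vec"
  have "vec_support ?e = {0}" using assms(1) by (auto simp: vec_support_def unit_vec_def split: if_splits)
  moreover have "(l2_norm ?e)\<^sup>2 = 1"
  proof -
    have "(l2_norm ?e)\<^sup>2 = (\<Sum>j<dim_col A. (cmod (?e $ j))\<^sup>2)"
      by (simp add: l2_norm_def L2_set_def sum_nonneg)
    also have "\<dots> = (\<Sum>j<dim_col A. if j = 0 then 1 else 0)"
      using assms(1) by (intro sum.cong) (auto simp: unit_vec_def)
    also have "\<dots> = 1" using assms(1) by simp
    finally show ?thesis .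
  qed
  ultimately have "1 - \<delta> \<le> 1 + \<delta>"
    using assms(2,3) unit_vec_carrier[of "dim_col A" 0] unfolding weighted_RIP_def weighted_card_def
    by fastforce
  then show ?thesis by simp
qed

text \<open>The set of admissible bounds is nonempty, because a matrix is a bounded operator, and bounded
  below by 0. So a bound on its infimum yields one of its elements.\<close>

lemma weighted_RIP_const_lessE:
  assumes "0 < dim_col A" "(\<omega> 0)\<^sup>2 \<le> k" "weighted_RIP_const \<omega> k A < d"
  obtains \<delta> where "0 \<le> \<delta>" "\<delta> < d" "weighted_RIP \<omega> k A \<delta>"
proof -
  let ?D = "{\<delta>. weighted_RIP \<omega> k A \<delta>}"
  obtain c where c: "0 \<le> c"
      "\<And>x. x \<in> carrier_vec (dim_col A) \<Longrightarrow> (l2_norm (A *\<^sub>v x))\<^sup>2 \<le> c * (l2_norm x)\<^sup>2"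
    using l2_norm_mult_mat_vec_bound by blast
  have "weighted_RIP \<omega> k A (1 + c)"
    unfolding weighted_RIP_def
  proof (intro ballI impI conjI)
    fix x :: "complex vec" assume x: "x \<in> carrier_vec (dim_col A)"
    have "(1 - (1 + c)) * (l2_norm x)\<^sup>2 \<le> 0" using c(1) by (simp add: mult_nonneg_nonneg)
    then show "(1 - (1 + c)) * (l2_norm x)\<^sup>2 \<le> (l2_norm (A *\<^sub>v x))\<^sup>2" by (rule order_trans) simp
    have "c * (l2_norm x)\<^sup>2 \<le> (1 + (1 + c)) * (l2_norm x)\<^sup>2" by (intro mult_right_mono) auto
    then show "(l2_norm (A *\<^sub>v x))\<^sup>2 \<le> (1 + (1 + c)) * (l2_norm x)\<^sup>2" using c(2)[OF x] by linarith
  qed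
  then have "?D \<noteq> {}" by blast
  moreover have "bdd_below ?D" using weighted_RIP_nonneg[of A \<omega> k, OF assms(1,2)] by (intro bdd_belowI[of _ 0]) auto
  ultimately have "\<exists>\<delta>\<in>?D. \<delta> < d"
    using assms(3) unfolding weighted_RIP_const_def weighted_RIP_def[symmetric] by (simp add: cInf_less_iff)
  then show ?thesis using that weighted_RIP_nonneg[of A \<omega> k, OF assms(1,2)] by blast
qed

lemma dim_vec_restrict [simp]: "dim_vec (vec_restrict v S) = dim_vec v"
  by (simp add: vec_restrict_def)

lemma vec_restrict_index: "i < dim_vec v \<Longrightarrow> vec_restrict v S $ i = (if i \<in> S then v $ i else 0)"
  by (simp add: vec_restrict_def)

lemma vec_restrict_carrier [simp]: "v \<in> carrier_vec N \<Longrightarrow> vec_restrict v S \<in> carrier_vec N"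
  by (intro carrier_vecI) (simp add: carrier_vecD)

lemma l2_norm_vec_restrict:
  assumes "v \<in> carrier_vec N" "U \<subseteq> {..<N}"
  shows "l2_norm (vec_restrict v U) = L2_set (\<lambda>j. cmod (v $ j)) U"
proof -
  have "(\<Sum>i<N. (cmod (vec_restrict v U $ i))\<^sup>2) = (\<Sum>i\<in>U. (cmod (v $ i))\<^sup>2)"
    using assms by (intro sum.mono_neutral_cong_right) (auto simp: vec_restrict_index)
  then show ?thesis using assms by (simp add: l2_norm_def L2_set_def)
qed

lemma weighted_l1_norm_vec_restrict:
  assumes "v \<in> carrier_vec N" "U \<subseteq> {..<N}"
  shows "weighted_l1_norm \<omega> (vec_restrict v U) = (\<Sum>j\<in>U. \<omega> j * cmod (v $ j))"
  unfolding weighted_l1_norm_def using assms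
  by (intro sum.mono_neutral_cong_right) (auto simp: vec_restrict_index)

lemma weighted_RIP_kernel_bound:
  assumes A: "dim_col A = N" and rip: "weighted_RIP \<omega> (k + l) A \<delta>" and \<delta>: "0 \<le> \<delta>" "\<delta> < 1"
    and v: "v \<in> mat_kernel A"
    and pos: "\<And>j. j < N \<Longrightarrow> 0 < \<omega> j" and b: "\<And>j. j < N \<Longrightarrow> (\<omega> j)\<^sup>2 \<le> b"
    and k: "0 \<le> b" "b < k" "0 \<le> l"
    and S: "S \<subseteq> {..<N}" "weighted_card \<omega> S \<le> l"
  shows "sqrt (1 - \<delta>) * L2_set (\<lambda>j. cmod (v $ j)) S
    \<le> sqrt (1 + \<delta>) * (sqrt k / (k - b)) * (\<Sum>j\<in>{..<N} - S. \<omega> j * cmod (v $ j))"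
proof -
  define P where "P U = l2_norm (A *\<^sub>v vec_restrict v U)" for U
  have A': "A \<in> carrier_mat (dim_row A) N" using A by auto
  have vN: "v \<in> carrier_vec N" and Av: "A *\<^sub>v v = 0\<^sub>v (dim_row A)"
    using v A unfolding mat_kernel_def by auto
  have nnP: "0 \<le> P U" for U by (simp add: P_def l2_norm_def)
  have split: "A *\<^sub>v vec_restrict v (U \<union> V) = A *\<^sub>v vec_restrict v U + A *\<^sub>v vec_restrict v V"
    if "U \<inter> V = {}" for U V
  proof -
    have "vec_restrict v (U \<union> V) = vec_restrict v U + vec_restrict v V"
      using that by (intro eq_vecI) (auto simp: vec_restrict_index)
    then show ?thesis using mult_add_distrib_mat_vec[OF A'] vN by simp
  qed
  have small: "(1 - \<delta>) * (L2_set (\<lambda>j. cmod (v $ j)) U)\<^sup>2 \<le> (P U)\<^sup>2 \<and>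
      (P U)\<^sup>2 \<le> (1 + \<delta>) * (L2_set (\<lambda>j. cmod (v $ j)) U)\<^sup>2"
    if U: "U \<subseteq> {..<N}" "(\<Sum>j\<in>U. (\<omega> j)\<^sup>2) \<le> k + l" for U
  proof -
    have "weighted_card \<omega> (vec_support (vec_restrict v U)) \<le> weighted_card \<omega> U"
      unfolding weighted_card_def vec_support_def using U(1) finite_subset[OF U(1)] vN
      by (intro sum_mono2) (auto simp: vec_restrict_index split: if_splits)
    then have "weighted_card \<omega> (vec_support (vec_restrict v U)) \<le> k + l"
      using U(2) by (simp add: weighted_card_def)
    moreover have "vec_restrict v U \<in> carrier_vec (dim_col A)" using vN A by simp
    ultimately show ?thesis
      using rip unfolding weighted_RIP_def P_def l2_norm_vec_restrict[OF vN U(1), symmetric] by blast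
  qed
  have up: "P U \<le> sqrt (1 + \<delta>) * L2_set (\<lambda>j. cmod (v $ j)) U"
    if "U \<subseteq> {..<N}" "(\<Sum>j\<in>U. (\<omega> j)\<^sup>2) \<le> k + l" for U
    using real_le_rsqrt[OF conjunct2[OF small[OF that]]] by (simp add: real_sqrt_mult)
  have low: "sqrt (1 - \<delta>) * L2_set (\<lambda>j. cmod (v $ j)) U \<le> P U"
    if "U \<subseteq> {..<N}" "(\<Sum>j\<in>U. (\<omega> j)\<^sup>2) \<le> k + l" for U
    using real_sqrt_le_mono[OF conjunct1[OF small[OF that]]] nnP by (simp add: real_sqrt_mult)
  show ?thesis
  proof (rule l2_robust_nsp_abstract[where P = P and I = "{..<N}" and a = "\<lambda>j. cmod (v $ j)"
        and \<omega> = \<omega> and b = b and k = k and l = l and S = S and c = "sqrt (1 + \<delta>)" and d = "sqrt (1 - \<delta>)"])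
    show "P (U \<union> V) \<le> P U + P V" if "U \<inter> V = {}" for U V
      unfolding P_def split[OF that] by (intro l2_norm_add_le[of _ "dim_row A"] mult_mat_vec_carrier[OF A'])
        (use vN in auto)
    show "P U = P ({..<N} - U)" if U: "U \<subseteq> {..<N}" for U
    proof -
      have "vec_restrict v (U \<union> ({..<N} - U)) = v"
        using vN U by (intro eq_vecI) (auto simp: vec_restrict_index)
      then have z: "A *\<^sub>v vec_restrict v U + A *\<^sub>v vec_restrict v ({..<N} - U) = 0\<^sub>v (dim_row A)"
        using split[of U "{..<N} - U"] Av by (metis Diff_disjoint)
      have "(A *\<^sub>v vec_restrict v U) $ i + (A *\<^sub>v vec_restrict v ({..<N} - U)) $ i = 0"
        if "i < dim_row A" for i
        using arg_cong[OF z, of "\<lambda>x. x $ i"] that by (simp del: index_mult_mat_vec)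
      then have "cmod ((A *\<^sub>v vec_restrict v U) $ i) = cmod ((A *\<^sub>v vec_restrict v ({..<N} - U)) $ i)"
        if "i < dim_row A" for i
        using that by (metis add_eq_0_iff norm_minus_cancel)
      then show ?thesis unfolding P_def l2_norm_def by (intro L2_set_cong) (auto simp del: index_mult_mat_vec)
    qed
    show "(\<Sum>j\<in>S. (\<omega> j)\<^sup>2) \<le> l" using S(2) by (simp add: weighted_card_def)
  qed (fact up low k S(1) | use pos b \<delta> in simp)+
qed

lemma ex_nonzero_kernel_vec:
  fixes A :: "'a :: field mat"
  assumes A: "A \<in> carrier_mat m N" and "m < N"
  shows "\<exists>v\<in>mat_kernel A. v \<noteq> 0\<^sub>v N"
proof -
  \<comment> \<open>Pad with zero rows to a square matrix, which is then singular.\<close>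
  define B where "B = mat\<^sub>r N N (\<lambda>i. if i = m then 0\<^sub>v N else if i < m then row A i else 0\<^sub>v N)"
  have B: "B \<in> carrier_mat N N" by (simp add: B_def)
  have "det B = 0" unfolding B_def using assms by (intro det_row_0) auto
  then obtain v where v: "v \<in> carrier_vec N" "v \<noteq> 0\<^sub>v N" "B *\<^sub>v v = 0\<^sub>v N"
    using det_0_iff_vec_prod_zero_field[OF B] by blast
  have "A *\<^sub>v v = 0\<^sub>v m"
  proof (rule eq_vecI)
    fix i assume "i < dim_vec (0\<^sub>v m :: 'a vec)"
    then have i: "i < m" by simp
    have "(A *\<^sub>v v) $ i = scalar_prod (row A i) v" using i A by simp
    also have "row A i = row B i" using i A assms(2) by (auto simp: B_def)
    also have "scalar_prod (row B i) v = (B *\<^sub>v v) $ i" using i B assms(2) by simp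
    also have "\<dots> = 0" using v(3) i assms(2) by simp
    finally show "(A *\<^sub>v v) $ i = 0\<^sub>v m $ i" using i by simp
  qed (use A in auto)
  then show ?thesis using v A by (intro bexI[of _ v]) (auto intro: mat_kernelI)
qed

section \<open>A matrix with a small restricted isometry constant\<close>

lemma sum_roots_of_unity_powers:
  assumes "j < N" "k < N"
  shows "(\<Sum>t<N. cis (2 * pi * (real j - real k) / real N) ^ t) = (if j = k then of_nat N else 0)"
proof (cases "j = k")
  case False
  let ?z = "cis (2 * pi * (real j - real k) / real N)"
  have N: "0 < real N" using assms by simp
  have "?z ^ N = cis (2 * pi * (real j - real k))" using N by (simp add: Complex.DeMoivre)
  also have "\<dots> = 1" by (intro cis_multiple_2pi) auto
  finally have "?z ^ N = 1" .
  moreover have "?z \<noteq> 1"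
  proof
    assume "?z = 1"
    then obtain n :: int where "2 * pi * (real j - real k) / real N = of_int n * (2 * pi)"
      unfolding cis_eq_1_iff by blast
    then have "2 * pi * (real j - real k) = 2 * pi * (of_int n * real N)"
      using N by (simp add: divide_eq_eq)
    then have "real j - real k = of_int n * real N" by simp
    then have "real_of_int (int j - int k) = real_of_int (n * int N)" by simp
    then have "int j - int k = n * int N" by (simp only: of_int_eq_iff)
    then have "int N dvd int j - int k" by simp
    then have "int N \<le> \<bar>int j - int k\<bar>" using False dvd_imp_le_int[of "int j - int k" "int N"] by simp
    then show False using assms by linarith
  qed
  ultimately show ?thesis using False by (simp add: sum_gp_strict)
qed simp

lemma fourier_orthonormal_system:
  assumes "0 < N"
  shows "orthonormal_system (measure_pmf (pmf_of_set (real ` {..<N}))) N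
    (\<lambda>j t. cis (2 * pi * real j * t / real N))"
proof -
  let ?p = "pmf_of_set (real ` {..<N})"
  have fin: "finite (real ` {..<N})" and ne: "real ` {..<N} \<noteq> {}" using assms by auto
  have set_p: "set_pmf ?p = real ` {..<N}" by (rule set_pmf_of_set[OF ne fin])
  have "(LINT t|measure_pmf ?p. cis (2 * pi * real j * t / real N) * cnj (cis (2 * pi * real k * t / real N)))
      = (if j = k then 1 else 0)" if "j < N" "k < N" for j k
  proof -
    have "(LINT t|measure_pmf ?p. cis (2 * pi * real j * t / real N) * cnj (cis (2 * pi * real k * t / real N)))
        = (\<Sum>t\<in>real ` {..<N}. pmf ?p t *\<^sub>R (cis (2 * pi * real j * t / real N) * cnj (cis (2 * pi * real k * t / real N))))"
      by (rule integral_measure_pmf) (use fin set_p in auto)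
    also have "\<dots> = (\<Sum>t\<in>{..<N}. cis (2 * pi * (real j - real k) / real N) ^ t / of_nat N)"
    proof (subst sum.reindex)
      show "inj_on real {..<N}" by simp
      have "pmf ?p (real t) *\<^sub>R (cis (2 * pi * real j * real t / real N) * cnj (cis (2 * pi * real k * real t / real N)))
          = cis (2 * pi * (real j - real k) / real N) ^ t / of_nat N" if t: "t < N" for t
      proof -
        have "pmf ?p (real t) = 1 / real N" using pmf_of_set[OF ne fin] t by (simp add: card_image)
        moreover have "2 * pi * real j * real t / real N + - (2 * pi * real k * real t / real N)
            = real t * (2 * pi * (real j - real k) / real N)"
          using assms by (simp add: field_simps)
        ultimately show ?thesis
          by (simp add: cis_cnj cis_mult Complex.DeMoivre scaleR_conv_of_real)
      qed
      then show "sum ((\<lambda>t. pmf ?p t *\<^sub>R (cis (2 * pi * real j * t / real N) * cnj (cis (2 * pi * real k * t / real N)))) \<circ> real) {..<N}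
          = (\<Sum>t\<in>{..<N}. cis (2 * pi * (real j - real k) / real N) ^ t / of_nat N)"
        by (intro sum.cong) simp_all
    qed
    also have "\<dots> = (if j = k then 1 else 0)"
      using sum_roots_of_unity_powers[OF that] assms by (simp flip: sum_divide_distrib)
    finally show ?thesis .
  qed
  then show ?thesis
    unfolding orthonormal_system_def using fin set_p by (auto intro: integrable_measure_pmf_finite)
qed

text \<open>The Fourier system on \<open>N\<close> equally weighted points is uniformly bounded by 1, hence by every
  weight, and the failure probability in the definition of \<open>C\<close> is less than one. So some
  realization of the random matrix is a restricted isometry.\<close>

lemma ex_matrix_weighted_RIP_const_le:
  assumes C: "rauhut_ward_constant C" and \<delta>: "0 < \<delta>" "\<delta> < 1" and N: "2 \<le> N"
    and \<omega>: "\<And>j. j < N \<Longrightarrow> 1 \<le> \<omega> j" and s: "2 * (weight_max N \<omega>)\<^sup>2 \<le> s" "1 \<le> s"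
    and m: "C * (1 / \<delta>\<^sup>2) * s * (ln s) ^ 3 * ln (real N) \<le> real m"
  shows "\<exists>A\<in>carrier_mat m N. weighted_RIP_const \<omega> s A \<le> \<delta>"
proof -
  let ?M = "measure_pmf (pmf_of_set (real ` {..<N}))"
  let ?\<psi> = "\<lambda>j t. cis (2 * pi * real j * t / real N)"
  let ?E = "{t \<in> space (Pi\<^sub>M {..<m} (\<lambda>_. ?M)). weighted_RIP_const \<omega> s (sampling_matrix m N ?\<psi> t) \<le> \<delta>}"
  have bounded: "\<forall>j<N. \<forall>t\<in>space ?M. cmod (?\<psi> j t) \<le> \<omega> j" using \<omega> by simp
  have "orthonormal_system ?M N ?\<psi>" using N by (intro fourier_orthonormal_system) simp
  then have "1 - real N powr (- ((ln s) ^ 3)) < measure (Pi\<^sub>M {..<m} (\<lambda>_. ?M)) ?E"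
    using \<delta> N bounded s(1) m
    by (intro conjunct2[OF C[unfolded rauhut_ward_constant_def], rule_format] prob_space_measure_pmf) simp_all
  moreover have "real N powr (- ((ln s) ^ 3)) \<le> real N powr 0"
    using N s(2) by (intro powr_mono) auto
  ultimately have "0 < measure (Pi\<^sub>M {..<m} (\<lambda>_. ?M)) ?E" using N by simp
  then have "?E \<noteq> {}" by (metis less_irrefl measure_empty)
  then obtain t where "weighted_RIP_const \<omega> s (sampling_matrix m N ?\<psi> t) \<le> \<delta>" by blast
  moreover have "sampling_matrix m N ?\<psi> t \<in> carrier_mat m N" by (simp add: sampling_matrix_def)
  ultimately show ?thesis by blast
qed

section \<open>Numerical bounds on kernel vectors\<close>

text \<open>A restricted isometry bound below 193/1000, which is slightly more than \<open>1 / sqrt 27\<close>, leaves a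
  margin in the null space property: at most the fraction 7/15, instead of 1/2, of the weighted norm
  of a kernel vector lies on an admissible set.\<close>

lemma weighted_RIP_l1_nsp:
  assumes A: "dim_col A = N" and rip: "weighted_RIP \<omega> (3 * s) A \<delta>" and \<delta>: "0 \<le> \<delta>" "\<delta> < 193/1000"
    and \<omega>: "\<And>j. j < N \<Longrightarrow> 0 < \<omega> j" "\<And>j. j < N \<Longrightarrow> \<omega> j \<le> W" and s: "0 < s" "23040 * W\<^sup>2 \<le> s"
    and u: "u \<in> mat_kernel A" and S: "S \<subseteq> {..<N}" "weighted_card \<omega> S \<le> s"
  shows "15 * (\<Sum>j\<in>S. \<omega> j * cmod (u $ j)) \<le> 7 * (\<Sum>j<N. \<omega> j * cmod (u $ j))"
proof -
  let ?L = "L2_set (\<lambda>j. cmod (u $ j)) S" and ?X = "\<Sum>j\<in>S. \<omega> j * cmod (u $ j)"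
  let ?R = "\<Sum>j\<in>{..<N} - S. \<omega> j * cmod (u $ j)"
  have R: "0 \<le> ?R" using \<omega>(1) by (intro sum_nonneg mult_nonneg_nonneg) (auto simp: less_imp_le)
  have d: "0 < 2 * s - W\<^sup>2" using s by (smt (verit) zero_le_power2)
  \<comment> \<open>Blocks of weight \<open>2 * s\<close> rather than \<open>s\<close> gain the factor \<open>sqrt 2\<close> that makes the constant
    less than one.\<close>
  have bound: "sqrt (1 - \<delta>) * ?L \<le> sqrt (1 + \<delta>) * (sqrt (2 * s) / (2 * s - W\<^sup>2)) * ?R"
  proof (rule weighted_RIP_kernel_bound[where l = s])
    show "weighted_RIP \<omega> (2 * s + s) A \<delta>" using rip by simp
    show "(\<omega> j)\<^sup>2 \<le> W\<^sup>2" if "j < N" for j using \<omega>[OF that] by (intro power_mono) auto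
  qed (use A \<delta> u \<omega> d S s in auto)
  have "?X = (\<Sum>j\<in>S. \<bar>\<omega> j\<bar> * \<bar>cmod (u $ j)\<bar>)"
    using \<omega>(1) S(1) by (intro sum.cong refl) (metis abs_norm_cancel abs_of_pos lessThan_iff subsetD)
  also have "\<dots> \<le> L2_set \<omega> S * ?L" by (rule L2_set_mult_ineq)
  also have "\<dots> \<le> sqrt s * ?L"
  proof (rule mult_right_mono[OF _ L2_set_nonneg])
    show "L2_set \<omega> S \<le> sqrt s" using S(2) by (simp add: L2_set_def weighted_card_def)
  qed
  finally have X: "?X \<le> sqrt s * ?L" .
  have r1: "898/1000 \<le> sqrt (1 - \<delta>)" using \<delta> by (intro real_le_rsqrt) (simp add: power2_eq_square)
  have r2: "sqrt (1 + \<delta>) * sqrt 2 \<le> 1545/1000"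
    unfolding real_sqrt_mult[symmetric] using \<delta>
    by (intro real_le_lsqrt) (auto simp: power2_eq_square)
  have X0: "0 \<le> ?X" using \<omega>(1) S(1) by (intro sum_nonneg mult_nonneg_nonneg) (auto simp: less_imp_le subset_iff)
  have "898/1000 * ?X \<le> sqrt (1 - \<delta>) * ?X" using r1 X0 by (intro mult_right_mono)
  also have "\<dots> \<le> sqrt (1 - \<delta>) * (sqrt s * ?L)" using X \<delta> by (intro mult_left_mono) auto
  also have "\<dots> = sqrt s * (sqrt (1 - \<delta>) * ?L)" by simp
  also have "\<dots> \<le> sqrt s * (sqrt (1 + \<delta>) * (sqrt (2 * s) / (2 * s - W\<^sup>2)) * ?R)"
    using bound s by (intro mult_left_mono) auto
  also have "\<dots> = sqrt (1 + \<delta>) * sqrt 2 * (s / (2 * s - W\<^sup>2)) * ?R"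
    using s by (simp add: real_sqrt_mult)
  also have "\<dots> \<le> 1545/1000 * (50002/100000) * ?R"
  proof (intro mult_right_mono mult_mono r2 R)
    have "s \<le> 50002/100000 * (2 * s - W\<^sup>2)" using s by simp
    then show "s / (2 * s - W\<^sup>2) \<le> 50002/100000" using d by (simp add: pos_divide_le_eq)
  qed (use s d in auto)
  finally have "8 * ?X \<le> 7 * ?R" using R by linarith
  moreover have "(\<Sum>j<N. \<omega> j * cmod (u $ j)) = ?R + ?X" by (rule sum.subset_diff) (use S in auto)
  ultimately show ?thesis by linarith
qed

text \<open>No single entry of a kernel vector can be large relative to the weighted norm. The conclusion
  involves only the null space, so a vector that violates it refutes the restricted isometry property
  for all matrices with that null space at once.\<close>

lemma weighted_RIP_kernel_entry_le:
  assumes B: "dim_col B = N" and rip: "weighted_RIP \<omega> (3 * s) B \<delta>" and \<delta>: "0 \<le> \<delta>" "\<delta> < 1/3"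
    and \<omega>: "\<And>j. j < N \<Longrightarrow> 0 < \<omega> j" "\<And>j. j < N \<Longrightarrow> \<omega> j \<le> W" and s: "0 < W" "23040 * W\<^sup>2 \<le> s"
    and v: "v \<in> mat_kernel B" and k: "k < N"
  shows "150 * W * cmod (v $ k) \<le> (\<Sum>j<N. \<omega> j * cmod (v $ j))"
proof -
  let ?X = "\<Sum>j<N. \<omega> j * cmod (v $ j)"
  have X: "0 \<le> ?X" using \<omega>(1) by (intro sum_nonneg mult_nonneg_nonneg) (auto simp: less_imp_le)
  have W2: "0 < W\<^sup>2" using s(1) by simp
  have s0: "0 < s" and d: "0 < 2 * s - W\<^sup>2" using s W2 by linarith+
  have sq: "(\<omega> j)\<^sup>2 \<le> W\<^sup>2" if "j < N" for j using \<omega>[OF that] by (intro power_mono) auto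
  have "sqrt (1 - \<delta>) * L2_set (\<lambda>j. cmod (v $ j)) {k}
      \<le> sqrt (1 + \<delta>) * (sqrt (2 * s) / (2 * s - W\<^sup>2)) * (\<Sum>j\<in>{..<N} - {k}. \<omega> j * cmod (v $ j))"
  proof (rule weighted_RIP_kernel_bound[where l = s])
    show "weighted_RIP \<omega> (2 * s + s) B \<delta>" using rip by simp
    have "(\<omega> k)\<^sup>2 \<le> s" using sq[OF k] s W2 by linarith
    then show "weighted_card \<omega> {k} \<le> s" by (simp add: weighted_card_def)
  qed (use B \<delta> v \<omega> d k s0 sq in auto)
  also have "\<dots> \<le> sqrt (1 + \<delta>) * (sqrt (2 * s) / (2 * s - W\<^sup>2)) * ?X"
    using \<omega>(1) d s0 \<delta> by (intro mult_left_mono sum_mono2 mult_nonneg_nonneg) (auto simp: less_imp_le)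
  also have "\<dots> \<le> sqrt (2 * (1 - \<delta>)) * (sqrt (2 * s) / (2 * s - W\<^sup>2)) * ?X"
    using \<delta> d s0 X by (intro mult_right_mono real_sqrt_le_mono) auto
  also have "\<dots> = sqrt (1 - \<delta>) * (2 * sqrt s / (2 * s - W\<^sup>2) * ?X)"
    unfolding real_sqrt_mult by simp
  finally have "sqrt (1 - \<delta>) * cmod (v $ k) \<le> sqrt (1 - \<delta>) * (2 * sqrt s / (2 * s - W\<^sup>2) * ?X)"
    by simp
  then have 1: "cmod (v $ k) \<le> 2 * sqrt s / (2 * s - W\<^sup>2) * ?X"
    by (rule mult_left_le_imp_le) (use \<delta> in simp)
  have "(151 * W)\<^sup>2 = 22801 * W\<^sup>2" by (simp add: power_mult_distrib)
  also have "\<dots> \<le> s" using s W2 by linarith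
  finally have root: "151 * W \<le> sqrt s" by (rule real_le_rsqrt)
  have "150 * W * (2 * sqrt s) \<le> 150 * (sqrt s / 151) * (2 * sqrt s)"
    using root s0 by (intro mult_right_mono) auto
  also have "\<dots> = 300 / 151 * s" using s0 by simp
  also have "\<dots> \<le> 2 * s - W\<^sup>2" using s W2 by linarith
  finally have 2: "150 * W * (2 * sqrt s / (2 * s - W\<^sup>2)) \<le> 1" using d by simp
  have "150 * W * cmod (v $ k) \<le> 150 * W * (2 * sqrt s / (2 * s - W\<^sup>2)) * ?X"
    using mult_left_mono[OF 1, of "150 * W"] s(1) by simp
  also have "\<dots> \<le> 1 * ?X" using 2 X by (rule mult_right_mono)
  finally show ?thesis by simp
qed

section \<open>A rank one perturbation of the kernel\<close>

text \<open>The matrix \<open>A * (1 - e\<^sub>k g\<^sup>T)\<close>. When \<open>g k = 0\<close>, its kernel is the image of the kernel of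
  \<open>A\<close> under \<open>u \<mapsto> u + (\<Sum>i. g i * u i) e\<^sub>k\<close>.\<close>

definition column_shear :: "complex mat \<Rightarrow> nat \<Rightarrow> (nat \<Rightarrow> complex) \<Rightarrow> complex mat" where
  "column_shear A k g = mat (dim_row A) (dim_col A) (\<lambda>(i, j). A $$ (i, j) - A $$ (i, k) * g j)"

lemma mat_kernel_column_shear:
  assumes A: "A \<in> carrier_mat m N" and k: "k < N"
  shows "v \<in> mat_kernel (column_shear A k g) \<longleftrightarrow> v \<in> carrier_vec N \<and>
    vec N (\<lambda>j. v $ j - (if j = k then \<Sum>i<N. g i * v $ i else 0)) \<in> mat_kernel A"
proof (cases "v \<in> carrier_vec N")
  case v: True
  let ?c = "\<Sum>i<N. g i * v $ i"
  let ?u = "vec N (\<lambda>j. v $ j - (if j = k then ?c else 0))"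
  have B: "column_shear A k g \<in> carrier_mat m N" using A by (simp add: column_shear_def)
  have "column_shear A k g *\<^sub>v v = A *\<^sub>v ?u"
  proof (rule eq_vecI)
    fix i assume "i < dim_vec (A *\<^sub>v ?u)"
    then have i: "i < m" using A by simp
    have "(column_shear A k g *\<^sub>v v) $ i = (\<Sum>j<N. (A $$ (i, j) - A $$ (i, k) * g j) * v $ j)"
      unfolding mult_mat_vec_index_sum[OF B v i] using A i by (simp add: column_shear_def)
    also have "\<dots> = (\<Sum>j<N. A $$ (i, j) * v $ j) - A $$ (i, k) * ?c"
      by (simp add: algebra_simps sum_subtractf sum_distrib_left)
    also have "A $$ (i, k) * ?c = (\<Sum>j<N. A $$ (i, j) * (if j = k then ?c else 0))"
      using k by (simp add: if_distrib[of "\<lambda>x. _ * x"] cong: if_cong)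
    also have "(\<Sum>j<N. A $$ (i, j) * v $ j) - \<dots> = (\<Sum>j<N. A $$ (i, j) * ?u $ j)"
      by (simp add: right_diff_distrib flip: sum_subtractf)
    also have "\<dots> = (A *\<^sub>v ?u) $ i" using mult_mat_vec_index_sum[OF A _ i, of ?u] by simp
    finally show "(column_shear A k g *\<^sub>v v) $ i = (A *\<^sub>v ?u) $ i" .
  qed (use A B in auto)
  then show ?thesis unfolding mat_kernel[OF A] mat_kernel[OF B] using v by simp
next
  case False
  have B: "column_shear A k g \<in> carrier_mat m N" using A by (simp add: column_shear_def)
  show ?thesis unfolding mat_kernel[OF B] using False by simp
qed

lemma weighted_l1_shift_le:
  fixes \<omega> :: "nat \<Rightarrow> real" and x y :: "nat \<Rightarrow> complex"
  assumes "finite U" and "\<And>j. j \<in> insert k U \<Longrightarrow> 0 \<le> \<omega> j"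
    and "\<And>j. j \<in> U \<Longrightarrow> y j = x j + (if j = k then c else 0)"
  shows "(\<Sum>j\<in>U. \<omega> j * cmod (y j)) \<le> (\<Sum>j\<in>U. \<omega> j * cmod (x j)) + \<omega> k * cmod c"
proof -
  have "(\<Sum>j\<in>U. \<omega> j * cmod (y j)) \<le> (\<Sum>j\<in>U. \<omega> j * cmod (x j) + (if j = k then \<omega> k * cmod c else 0))"
  proof (rule sum_mono)
    fix j assume j: "j \<in> U"
    have "cmod (y j) \<le> cmod (x j) + (if j = k then cmod c else 0)"
      using assms(3)[OF j] norm_triangle_ineq[of "x j" c] by auto
    then have "\<omega> j * cmod (y j) \<le> \<omega> j * (cmod (x j) + (if j = k then cmod c else 0))"
      using assms(2) j by (intro mult_left_mono) auto
    then show "\<omega> j * cmod (y j) \<le> \<omega> j * cmod (x j) + (if j = k then \<omega> k * cmod c else 0)"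
      by (simp add: distrib_left split: if_splits)
  qed
  also have "\<dots> = (\<Sum>j\<in>U. \<omega> j * cmod (x j)) + (if k \<in> U then \<omega> k * cmod c else 0)"
    using assms(1) by (simp add: sum.distrib)
  also have "\<dots> \<le> (\<Sum>j\<in>U. \<omega> j * cmod (x j)) + \<omega> k * cmod c"
    using assms(2) by simp
  finally show ?thesis .
qed

section \<open>The null space property without the restricted isometry property\<close>

theorem theorem4p5:
  fixes C :: real and \<omega> :: "nat \<Rightarrow> real" and m s N :: nat
  assumes "rauhut_ward_constant C"
    and "m > 0" and "s > 0" and "N > 0"
    and "\<And>j. j < N \<Longrightarrow> \<omega> j \<ge> 1"
    and "real N / 2 \<ge> real m"
    and "real m \<ge> 81 * C * real s * (ln (3 * real s)) ^ 3 * ln (real N)"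
    and "real N \<ge> 24 * (weight_max N \<omega>)\<^sup>2 * real s"
    and "real s > 23040 * (weight_max N \<omega>) ^ 6"
  shows "\<exists>\<Phi> \<in> carrier_mat m N.
    weighted_NSP \<omega> (real s) \<Phi> \<and>
    \<not> (\<exists>\<delta> < 1/3. weighted_RIP_NSP \<omega> (3 * real s) \<delta> \<Phi>)"
proof -
  define W where "W = weight_max N \<omega>"
  have \<omega>W: "\<omega> j \<le> W" if "j < N" for j
    using that unfolding W_def weight_max_def by (intro Max_ge) auto
  have \<omega>pos: "0 < \<omega> j" if "j < N" for j using assms(5)[OF that] by linarith
  have W: "1 \<le> W" using assms(5)[OF assms(4)] \<omega>W[OF assms(4)] by linarith
  have WW: "W \<le> W\<^sup>2" using W by (simp add: power2_eq_square)
  have "W\<^sup>2 \<le> W ^ 6" using W by (intro power_increasing) auto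
  then have s: "23040 * W\<^sup>2 \<le> real s" using assms(9) unfolding W_def by linarith
  \<comment> \<open>\<open>24 * 23040 = 552960\<close>\<close>
  have "1 * real s \<le> W\<^sup>2 * real s" using W WW by (intro mult_right_mono) auto
  then have N: "552960 * W \<le> real N" using assms(8) s WW unfolding W_def[symmetric] by linarith
  have \<omega>0: "(\<omega> 0)\<^sup>2 \<le> 3 * real s"
  proof -
    have "(\<omega> 0)\<^sup>2 \<le> W\<^sup>2" using \<omega>W[OF assms(4)] \<omega>pos[OF assms(4)] by (intro power_mono) auto
    then show ?thesis using s by linarith
  qed
  obtain A where A: "A \<in> carrier_mat m N" "weighted_RIP_const \<omega> (3 * real s) A \<le> sqrt (1 / 27)"
  proof -
    have "\<exists>A\<in>carrier_mat m N. weighted_RIP_const \<omega> (3 * real s) A \<le> sqrt (1 / 27)"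
    proof (rule ex_matrix_weighted_RIP_const_le[OF assms(1)])
      show "2 \<le> N" using N W by simp
      show "2 * (weight_max N \<omega>)\<^sup>2 \<le> 3 * real s" using s unfolding W_def[symmetric] by linarith
      show "1 \<le> 3 * real s" using assms(3) by simp
      show "C * (1 / (sqrt (1 / 27))\<^sup>2) * (3 * real s) * ln (3 * real s) ^ 3 * ln (real N) \<le> real m"
        using assms(7) by simp
    qed (use assms(5) in auto)
    then show ?thesis using that by blast
  qed
  have dimA: "dim_col A = N" using A(1) by simp
  have "sqrt (1 / 27) < 193 / 1000" by (rule real_less_lsqrt) (auto simp: power2_eq_square)
  then have "weighted_RIP_const \<omega> (3 * real s) A < 193 / 1000" using A(2) by linarith
  then obtain \<delta> where \<delta>: "0 \<le> \<delta>" "\<delta> < 193 / 1000" "weighted_RIP \<omega> (3 * real s) A \<delta>"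
    using weighted_RIP_const_lessE[of A \<omega>, OF _ \<omega>0] dimA assms(4) by blast
  have "m < N" using assms(4,6) by linarith
  then obtain u where u: "u \<in> mat_kernel A" "u \<noteq> 0\<^sub>v N" using ex_nonzero_kernel_vec[OF A(1)] by blast
  have uN: "u \<in> carrier_vec N" using u(1) A(1) mat_kernel_carrier by blast
  define a where "a j = \<omega> j * cmod (u $ j)" for j
  define X where "X = (\<Sum>j<N. a j)"
  have a0: "0 \<le> a j" if "j < N" for j using \<omega>pos[OF that] by (simp add: a_def)
  obtain i where i: "i < N" "u $ i \<noteq> 0"
    using u(2) uN by (metis carrier_vecD eq_vecI index_zero_vec)
  have "0 < a i" using i \<omega>pos by (simp add: a_def)
  also have "a i \<le> X" unfolding X_def using i(1) a0 by (intro member_le_sum) auto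
  finally have X: "0 < X" .
  \<comment> \<open>The spike is put where \<open>u\<close> is smallest, so that \<open>u\<close> cannot cancel it.\<close>
  have "Min (a ` {..<N}) \<in> a ` {..<N}" using assms(4) by (intro Min_in) auto
  then obtain k where k: "k < N" "a k = Min (a ` {..<N})" by auto
  have ak: "a k \<le> a j" if "j < N" for j using k(2) that by simp
  have "real N * a k \<le> X"
    unfolding X_def using sum_bounded_below[of "{..<N}" "a k" a] ak by simp
  moreover have "552960 * W * a k \<le> real N * a k" using N a0[OF k(1)] by (rule mult_right_mono)
  ultimately have akX: "552960 * (W * a k) \<le> X" by simp
  \<comment> \<open>The functional \<open>g\<close> has norm at most \<open>e\<close> in the dual of the weighted \<open>\<ell>\<^sub>1\<close> norm, nearly
    attained at \<open>u\<close>. The value 60 lets the perturbed fraction \<open>7/15 * 61/60 + 1/60\<close> stay below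
    1/2, while \<open>150 / 60\<close> stays above the \<open>61/60\<close> that the entry bound permits.\<close>
  define e where "e = 1 / (60 * W)"
  have e: "0 < e" "W * e = 1 / 60" using W by (simp_all add: e_def)
  define g where "g j = (if j = k then 0 else complex_of_real (e * \<omega> j) * cnj (sgn (u $ j)))" for j
  have g_le: "cmod (g j) \<le> e * \<omega> j" if "j < N" for j
    using e(1) \<omega>pos[OF that] by (auto simp: g_def norm_mult norm_sgn)
  have c_le: "\<omega> k * cmod (\<Sum>j<N. g j * x $ j) \<le> (\<Sum>j<N. \<omega> j * cmod (x $ j)) / 60" for x :: "complex vec"
  proof -
    have "cmod (\<Sum>j<N. g j * x $ j) \<le> (\<Sum>j<N. cmod (g j) * cmod (x $ j))"
      by (rule norm_sum[THEN order_trans]) (simp add: norm_mult)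
    also have "\<dots> \<le> (\<Sum>j<N. e * \<omega> j * cmod (x $ j))"
      using g_le by (intro sum_mono mult_right_mono) auto
    also have "\<dots> = e * (\<Sum>j<N. \<omega> j * cmod (x $ j))" by (simp add: sum_distrib_left mult.assoc)
    finally have "\<omega> k * cmod (\<Sum>j<N. g j * x $ j) \<le> W * (e * (\<Sum>j<N. \<omega> j * cmod (x $ j)))"
      using \<omega>W[OF k(1)] W by (intro mult_mono) auto
    also have "\<dots> = (W * e) * (\<Sum>j<N. \<omega> j * cmod (x $ j))" by simp
    finally show ?thesis using e(2) by simp
  qed
  define \<Phi> where "\<Phi> = column_shear A k g"
  have \<Phi>: "\<Phi> \<in> carrier_mat m N" using A(1) by (simp add: \<Phi>_def column_shear_def)
  have dim\<Phi>: "dim_col \<Phi> = N" using \<Phi> by simp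
  note ker\<Phi> = mat_kernel_column_shear[OF A(1) k(1), of _ g, folded \<Phi>_def]
  have \<omega>nn: "0 \<le> \<omega> j" if "j < N" for j using \<omega>pos[OF that] by simp
  have "weighted_NSP \<omega> (real s) \<Phi>"
    unfolding weighted_NSP_def dim\<Phi>
  proof (intro ballI allI impI)
    fix v S
    assume v: "v \<in> mat_kernel \<Phi> - {0\<^sub>v N}" and S: "S \<subseteq> {..<N}" "weighted_card \<omega> S \<le> real s"
    define c where "c = (\<Sum>j<N. g j * v $ j)"
    define w where "w = vec N (\<lambda>j. v $ j - (if j = k then c else 0))"
    have vN: "v \<in> carrier_vec N" and w: "w \<in> mat_kernel A"
      using v ker\<Phi>[of v] unfolding w_def c_def by auto
    let ?V = "\<Sum>j<N. \<omega> j * cmod (v $ j)"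
    obtain i where i: "i < N" "v $ i \<noteq> 0"
      using v vN by (metis DiffD2 carrier_vecD eq_vecI index_zero_vec singletonI)
    have "0 < \<omega> i * cmod (v $ i)" using i \<omega>pos by simp
    also have "\<dots> \<le> ?V" using i(1) \<omega>nn by (intro member_le_sum) auto
    finally have V: "0 < ?V" .
    have ck: "\<omega> k * cmod c \<le> ?V / 60" unfolding c_def by (rule c_le)
    have "(\<Sum>j\<in>S. \<omega> j * cmod (v $ j)) \<le> (\<Sum>j\<in>S. \<omega> j * cmod (w $ j)) + \<omega> k * cmod c"
      by (rule weighted_l1_shift_le)
        (use S(1) \<omega>nn k(1) finite_subset[OF S(1)] in \<open>auto simp: w_def subset_iff\<close>)
    moreover have "(\<Sum>j<N. \<omega> j * cmod (w $ j)) \<le> ?V + \<omega> k * cmod (- c)"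
      by (rule weighted_l1_shift_le) (use \<omega>nn k(1) in \<open>auto simp: w_def\<close>)
    moreover have "15 * (\<Sum>j\<in>S. \<omega> j * cmod (w $ j)) \<le> 7 * (\<Sum>j<N. \<omega> j * cmod (w $ j))"
      by (rule weighted_RIP_l1_nsp[OF dimA \<delta>(3,1,2) \<omega>pos \<omega>W _ s w S]) (use assms(3) in auto)
    ultimately have "2 * (\<Sum>j\<in>S. \<omega> j * cmod (v $ j)) < ?V" using ck V unfolding norm_minus_cancel by linarith
    moreover have "?V = (\<Sum>j\<in>{..<N} - S. \<omega> j * cmod (v $ j)) + (\<Sum>j\<in>S. \<omega> j * cmod (v $ j))"
      by (rule sum.subset_diff) (use S(1) in auto)
    ultimately show "weighted_l1_norm \<omega> (vec_restrict v S) < weighted_l1_norm \<omega> (vec_restrict v ({..<N} - S))"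
      using vN S(1) by (simp add: weighted_l1_norm_vec_restrict)
  qed
  moreover have "\<not> weighted_RIP_NSP \<omega> (3 * real s) d \<Phi>" if d: "d < 1/3" for d
  proof
    assume "weighted_RIP_NSP \<omega> (3 * real s) d \<Phi>"
    then obtain \<Psi> where \<Psi>: "dim_col \<Psi> = N" "mat_kernel \<Psi> = mat_kernel \<Phi>"
      "weighted_RIP_const \<omega> (3 * real s) \<Psi> < 1/3"
      using d dim\<Phi> unfolding weighted_RIP_NSP_def by auto
    obtain \<eta> where \<eta>: "0 \<le> \<eta>" "\<eta> < 1/3" "weighted_RIP \<omega> (3 * real s) \<Psi> \<eta>"
      using weighted_RIP_const_lessE[of \<Psi> \<omega>, OF _ \<omega>0 \<Psi>(3)] \<Psi>(1) assms(4) by blast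
    \<comment> \<open>The image of \<open>u\<close> in the kernel of \<open>\<Phi>\<close>; its entry \<open>k\<close> exceeds the entry bound.\<close>
    define c where "c = (\<Sum>j<N. g j * u $ j)"
    define v where "v = vec N (\<lambda>j. u $ j + (if j = k then c else 0))"
    have "(\<Sum>j<N. g j * v $ j) = c"
      unfolding c_def by (intro sum.cong) (auto simp: v_def g_def)
    then have "vec N (\<lambda>j. v $ j - (if j = k then \<Sum>i<N. g i * v $ i else 0)) = u"
      using uN by (intro eq_vecI) (auto simp: v_def)
    then have "v \<in> mat_kernel \<Phi>" using ker\<Phi>[of v] u(1) by (simp add: v_def)
    then have "v \<in> mat_kernel \<Psi>" using \<Psi>(2) by simp
    then have "150 * W * cmod (v $ k) \<le> (\<Sum>j<N. \<omega> j * cmod (v $ j))"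
      using W by (intro weighted_RIP_kernel_entry_le[OF \<Psi>(1) \<eta>(3,1,2) \<omega>pos \<omega>W _ s _ k(1)]) auto
    also have "\<dots> \<le> (\<Sum>j<N. \<omega> j * cmod (u $ j)) + \<omega> k * cmod c"
      by (rule weighted_l1_shift_le) (use \<omega>nn k(1) in \<open>auto simp: v_def\<close>)
    also have "\<dots> \<le> X + X / 60" using c_le[of u] by (simp add: X_def a_def c_def)
    finally have upper: "150 * (W * cmod (v $ k)) \<le> 61 / 60 * X" by simp
    have "c = (\<Sum>j<N. complex_of_real (if j = k then 0 else e * a j))"
      unfolding c_def
    proof (intro sum.cong refl)
      fix j
      have "cnj (sgn (u $ j)) * u $ j = complex_of_real (cmod (u $ j))"
        by (cases "u $ j = 0")
          (simp_all add: sgn_eq complex_norm_square[symmetric] mult.commute[of "cnj _"] power2_eq_square)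
      then show "g j * u $ j = complex_of_real (if j = k then 0 else e * a j)"
        by (simp add: g_def a_def mult.assoc)
    qed
    also have "\<dots> = complex_of_real (\<Sum>j<N. if j = k then 0 else e * a j)" by simp
    also have "(\<Sum>j<N. if j = k then 0 else e * a j) = (\<Sum>j<N. e * a j - (if j = k then e * a k else 0))"
      by (intro sum.cong) auto
    also have "\<dots> = e * (X - a k)"
      using k(1) by (simp add: sum_subtractf X_def sum_distrib_left right_diff_distrib)
    finally have c: "c = complex_of_real (e * (X - a k))" .
    have "1 * a k \<le> W * a k" using W a0[OF k(1)] by (intro mult_right_mono) auto
    then have akX': "a k \<le> W * a k" "a k \<le> X" using akX a0[OF k(1)] by linarith+
    have "cmod (u $ k) \<le> a k" using assms(5)[OF k(1)] mult_right_mono[of 1 "\<omega> k" "cmod (u $ k)"] by (simp add: a_def)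
    moreover have "cmod c = e * (X - a k)" unfolding c norm_of_real using e(1) akX' by simp
    moreover have "cmod c \<le> cmod (v $ k) + cmod (u $ k)"
      using norm_triangle_ineq4[of "v $ k" "u $ k"] k(1) by (simp add: v_def)
    ultimately have "e * (X - a k) - a k \<le> cmod (v $ k)" by linarith
    then have "W * (e * (X - a k) - a k) \<le> W * cmod (v $ k)" using W by (intro mult_left_mono) auto
    moreover have "W * (e * (X - a k) - a k) = (W * e) * (X - a k) - W * a k" by (simp add: algebra_simps)
    ultimately have "(X - a k) / 60 - W * a k \<le> W * cmod (v $ k)" using e(2) by simp
    then have "X - a k - 60 * (W * a k) \<le> 60 * (W * cmod (v $ k))" by (simp add: field_simps)
    moreover have "9000 * (W * cmod (v $ k)) \<le> 61 * X" using upper by simp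
    ultimately have "89 * X \<le> 9150 * (W * a k)" using akX'(1) by linarith
    then show False using akX X by linarith
  qed
  ultimately show ?thesis using \<Phi> by blast
qed

end
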